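(* Let $Z=z_1e_1+z_2e_2$, $\mathcal{V}=\nu_1e_1+\nu_2e_2=\alpha+j\beta$ ($\alpha,\beta\in\mathbb{C}(i)$), $C=c_1e_1+c_2e_2\in\mathbb{BC}$ with $\Re(\alpha)+1>|\Im(\beta)|$ and $Z\notin\mathbb{O}_2$. Then the bicomplex Miller-Ross function $U=E_{\mathcal{V},C}(Z)$ satisfies the differential equation $$Z\frac{d^2U}{dZ^2}+(1-\mathcal{V}-CZ)\frac{dU}{dZ}+(\mathcal{V}-1)CU=0.$$
   Context: Bicomplex numbers: $\mathbb{BC}=\{w_1+jw_2: w_1,w_2\in\mathbb{C}(i)\}$, where $\mathbb{C}(i)$ is the complex field with unit $i$, $i^2=j^2=-1$, $ij=ji$. Put $e_1=\frac{1+ij}{2}$, $e_2=\frac{1-ij}{2}$, so $e_1+e_2=1$, $e_l^2=e_l$, $e_1e_2=0$. Every $Z=w_1+jw_2$ is uniquely $Z=z_1e_1+z_2e_2$ with $z_1=w_1-iw_2$, $z_2=w_1+iw_2\in\mathbb{C}(i)$, and addition, multiplication and division are componentwise in $e_1,e_2$. The set of zero divisors (singular elements) is $\mathbb{O}_2=\{w_1+jw_2: w_1^2+w_2^2=0\}$, i.e. $z_1z_2=0$. Functions act componentwise: $\Gamma(Y)=\Gamma(y_1)e_1+\Gamma(y_2)e_2$ for $Y=y_1e_1+y_2e_2$ (with $1/\Gamma$ equal to $0$ at the poles of $\Gamma$), and $Z^{W}=z_1^{w_1}e_1+z_2^{w_2}e_2$ for $Z=z_1e_1+z_2e_2$, $W=w_1e_1+w_2e_2$,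 where the complex powers are taken with a branch of the logarithm that is holomorphic near the point considered. Bicomplex Miller-Ross function: $E_{\mathcal{V},C}(Z)=Z^{\mathcal{V}}\sum_{r=0}^{\infty}\frac{(CZ)^r}{\Gamma(\mathcal{V}+r+1)}$ for $\mathcal{V},C,Z\in\mathbb{BC}$. Bicomplex derivative: $\frac{df}{dZ}(Z_0)=\lim\frac{f(Z_0+\Delta Z)-f(Z_0)}{\Delta Z}$ as $\Delta Z\to0$, $\Delta Z\notin\mathbb{O}_2$; for $f(Z)=f_1(z_1)e_1+f_2(z_2)e_2$ with $f_1,f_2$ holomorphic it equals $f_1'(z_1)e_1+f_2'(z_2)e_2$. *)

theory Defs
  imports "HOL-Analysis.Analysis"
begin

text \<open>The element \<open>BC w1 w2\<close> stands for \<open>w1 + j w2\<close> with \<open>w1, w2 \<in> \<complex>(i)\<close>.\<close>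

datatype bicomplex = BC (bc_w1: complex) (bc_w2: complex)

lemma bicomplex_eq_iff: "X = Y \<longleftrightarrow> bc_w1 X = bc_w1 Y \<and> bc_w2 X = bc_w2 Y"
  by (cases X; cases Y) simp

instantiation bicomplex :: comm_ring_1
begin

definition zero_bicomplex :: bicomplex where
  "0 = BC 0 0"

definition one_bicomplex :: bicomplex where
  "1 = BC 1 0"

definition uminus_bicomplex :: "bicomplex \<Rightarrow> bicomplex" where
  "- X = BC (- bc_w1 X) (- bc_w2 X)"

definition plus_bicomplex :: "bicomplex \<Rightarrow> bicomplex \<Rightarrow> bicomplex" where
  "X + Y = BC (bc_w1 X + bc_w1 Y) (bc_w2 X + bc_w2 Y)"

definition minus_bicomplex :: "bicomplex \<Rightarrow> bicomplex \<Rightarrow> bicomplex" where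
  "X - Y = BC (bc_w1 X - bc_w1 Y) (bc_w2 X - bc_w2 Y)"

definition times_bicomplex :: "bicomplex \<Rightarrow> bicomplex \<Rightarrow> bicomplex" where
  "X * Y = BC (bc_w1 X * bc_w1 Y - bc_w2 X * bc_w2 Y) (bc_w1 X * bc_w2 Y + bc_w2 X * bc_w1 Y)"

instance
  by standard
    (auto simp: bicomplex_eq_iff zero_bicomplex_def one_bicomplex_def uminus_bicomplex_def
      plus_bicomplex_def minus_bicomplex_def times_bicomplex_def algebra_simps)

end

lemma bc_w_simps [simp]:
  "bc_w1 0 = 0" "bc_w2 0 = 0"
  "bc_w1 1 = 1" "bc_w2 1 = 0"
  "bc_w1 (- X) = - bc_w1 X" "bc_w2 (- X) = - bc_w2 X"
  "bc_w1 (X + Y) = bc_w1 X + bc_w1 Y" "bc_w2 (X + Y) = bc_w2 X + bc_w2 Y"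
  "bc_w1 (X - Y) = bc_w1 X - bc_w1 Y" "bc_w2 (X - Y) = bc_w2 X - bc_w2 Y"
  "bc_w1 (X * Y) = bc_w1 X * bc_w1 Y - bc_w2 X * bc_w2 Y"
  "bc_w2 (X * Y) = bc_w1 X * bc_w2 Y + bc_w2 X * bc_w1 Y"
  by (simp_all add: zero_bicomplex_def one_bicomplex_def uminus_bicomplex_def
      plus_bicomplex_def minus_bicomplex_def times_bicomplex_def)

text \<open>The topology is that of \<open>\<complex>\<^sup>2\<close>. The Euclidean norm is not submultiplicative here, so only
  the classes \<open>real_normed_vector\<close> and \<open>real_algebra_1\<close> are instantiated.\<close>

instantiation bicomplex :: real_algebra_1
begin

definition scaleR_bicomplex :: "real \<Rightarrow> bicomplex \<Rightarrow> bicomplex" where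
  "scaleR r X = BC (r *\<^sub>R bc_w1 X) (r *\<^sub>R bc_w2 X)"

instance
  by standard (simp_all add: bicomplex_eq_iff scaleR_bicomplex_def algebra_simps)

end

instantiation bicomplex :: real_normed_vector
begin

definition norm_bicomplex :: "bicomplex \<Rightarrow> real" where
  "norm X = sqrt ((norm (bc_w1 X))\<^sup>2 + (norm (bc_w2 X))\<^sup>2)"

definition dist_bicomplex :: "bicomplex \<Rightarrow> bicomplex \<Rightarrow> real" where
  "dist X Y = norm (X - Y :: bicomplex)"

definition sgn_bicomplex :: "bicomplex \<Rightarrow> bicomplex" where
  "sgn X = scaleR (inverse (norm X)) (X :: bicomplex)"

definition uniformity_bicomplex :: "(bicomplex \<times> bicomplex) filter" where
  "uniformity = (INF e\<in>{0 <..}. principal {(X :: bicomplex, Y). dist X Y < e})"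

definition open_bicomplex :: "bicomplex set \<Rightarrow> bool" where
  "open (S :: bicomplex set) \<longleftrightarrow> (\<forall>X\<in>S. \<forall>\<^sub>F (X', Y) in uniformity. X' = X \<longrightarrow> Y \<in> S)"

instance
proof
  fix r :: real and X Y :: bicomplex and S :: "bicomplex set"
  have norm_eq: "norm W = norm (bc_w1 W, bc_w2 W)" for W :: bicomplex
    by (simp add: norm_bicomplex_def norm_Pair)
  show "dist X Y = norm (X - Y)"
    by (rule dist_bicomplex_def)
  show "sgn X = inverse (norm X) *\<^sub>R X"
    by (rule sgn_bicomplex_def)
  show "uniformity = (INF e\<in>{0 <..}. principal {(X :: bicomplex, Y). dist X Y < e})"
    by (rule uniformity_bicomplex_def)
  show "open S = (\<forall>X\<in>S. \<forall>\<^sub>F (X', Y) in uniformity. X' = X \<longrightarrow> Y \<in> S)"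
    by (rule open_bicomplex_def)
  show "norm X = 0 \<longleftrightarrow> X = 0"
    by (simp add: norm_eq bicomplex_eq_iff prod_eq_iff)
  show "norm (X + Y) \<le> norm X + norm Y"
    using norm_triangle_ineq[of "(bc_w1 X, bc_w2 X)" "(bc_w1 Y, bc_w2 Y)"]
    by (simp add: norm_eq)
  show "norm (r *\<^sub>R X) = \<bar>r\<bar> * norm X"
    using norm_scaleR[of r "(bc_w1 X, bc_w2 X)"]
    by (simp add: norm_eq scaleR_bicomplex_def)
qed

end

definition bc_of_complex :: "complex \<Rightarrow> bicomplex" where
  "bc_of_complex w = BC w 0"

definition bc_j :: bicomplex where
  "bc_j = BC 0 1"

lemma BC_eq: "BC w1 w2 = bc_of_complex w1 + bc_j * bc_of_complex w2"
  by (simp add: bicomplex_eq_iff bc_of_complex_def bc_j_def)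

lemma bc_j_squared: "bc_j\<^sup>2 = - 1"
  by (simp add: bicomplex_eq_iff bc_j_def power2_eq_square)

definition bc_e1 :: bicomplex where
  "bc_e1 = (1 / 2) *\<^sub>R (1 + bc_of_complex \<i> * bc_j)"

definition bc_e2 :: bicomplex where
  "bc_e2 = (1 / 2) *\<^sub>R (1 - bc_of_complex \<i> * bc_j)"

definition bc_z1 :: "bicomplex \<Rightarrow> complex" where
  "bc_z1 Z = bc_w1 Z - \<i> * bc_w2 Z"

definition bc_z2 :: "bicomplex \<Rightarrow> complex" where
  "bc_z2 Z = bc_w1 Z + \<i> * bc_w2 Z"

definition bc_idem :: "complex \<Rightarrow> complex \<Rightarrow> bicomplex" where
  "bc_idem z1 z2 = bc_of_complex z1 * bc_e1 + bc_of_complex z2 * bc_e2"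

lemma bc_e_simps:
  "bc_e1 + bc_e2 = 1" "bc_e1 * bc_e1 = bc_e1" "bc_e2 * bc_e2 = bc_e2" "bc_e1 * bc_e2 = 0"
  by (simp_all add: bicomplex_eq_iff bc_e1_def bc_e2_def bc_of_complex_def bc_j_def
      scaleR_bicomplex_def complex_eq_iff)

lemma bc_idem_z [simp]: "bc_idem (bc_z1 Z) (bc_z2 Z) = Z"
  by (simp add: bicomplex_eq_iff bc_idem_def bc_z1_def bc_z2_def bc_e1_def bc_e2_def
      bc_of_complex_def bc_j_def scaleR_bicomplex_def complex_eq_iff field_simps)

lemma bc_z_idem [simp]: "bc_z1 (bc_idem z1 z2) = z1" "bc_z2 (bc_idem z1 z2) = z2"
  by (simp_all add: bc_idem_def bc_z1_def bc_z2_def bc_e1_def bc_e2_def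
      bc_of_complex_def bc_j_def scaleR_bicomplex_def complex_eq_iff field_simps)

lemma bicomplex_eq_iff_z: "X = Y \<longleftrightarrow> bc_z1 X = bc_z1 Y \<and> bc_z2 X = bc_z2 Y"
  by (metis bc_idem_z)

lemma bc_z_simps [simp]:
  "bc_z1 0 = 0" "bc_z2 0 = 0" "bc_z1 1 = 1" "bc_z2 1 = 1"
  "bc_z1 (X + Y) = bc_z1 X + bc_z1 Y" "bc_z2 (X + Y) = bc_z2 X + bc_z2 Y"
  "bc_z1 (X - Y) = bc_z1 X - bc_z1 Y" "bc_z2 (X - Y) = bc_z2 X - bc_z2 Y"
  "bc_z1 (X * Y) = bc_z1 X * bc_z1 Y" "bc_z2 (X * Y) = bc_z2 X * bc_z2 Y"
  by (simp_all add: bc_z1_def bc_z2_def complex_eq_iff algebra_simps)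

text \<open>Division is componentwise with respect to \<open>e1, e2\<close>; by HOL's convention \<open>inverse 0 = 0\<close> in each
  component it is total, and it is the true division whenever the divisor is nonsingular.\<close>

instantiation bicomplex :: inverse
begin

definition inverse_bicomplex :: "bicomplex \<Rightarrow> bicomplex" where
  "inverse X = bc_idem (inverse (bc_z1 X)) (inverse (bc_z2 X))"

definition divide_bicomplex :: "bicomplex \<Rightarrow> bicomplex \<Rightarrow> bicomplex" where
  "X div Y = X * inverse (Y :: bicomplex)"

instance ..

end

definition bc_O2 :: "bicomplex set" where
  "bc_O2 = {Z. (bc_w1 Z)\<^sup>2 + (bc_w2 Z)\<^sup>2 = 0}"

lemma bc_O2_iff: "Z \<in> bc_O2 \<longleftrightarrow> bc_z1 Z * bc_z2 Z = 0"
proof -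
  have "bc_z1 Z * bc_z2 Z = (bc_w1 Z)\<^sup>2 + (bc_w2 Z)\<^sup>2"
    by (simp add: bc_z1_def bc_z2_def complex_eq_iff power2_eq_square algebra_simps)
  then show ?thesis
    by (simp add: bc_O2_def)
qed

lemma bc_right_inverse: "Z \<notin> bc_O2 \<Longrightarrow> Z * inverse Z = 1"
  by (simp add: bc_O2_iff bicomplex_eq_iff_z inverse_bicomplex_def)

text \<open>HOL sets \<open>Gamma\<close> to \<open>0\<close> at its poles, so with the componentwise division above a quotient
  \<open>X / bc_Gamma Y\<close> has component \<open>0\<close> wherever \<open>Y\<close> has a pole component, i.e. \<open>1/\<Gamma> = 0\<close> there.\<close>

definition bc_Gamma :: "bicomplex \<Rightarrow> bicomplex" where
  "bc_Gamma Y = bc_idem (Gamma (bc_z1 Y)) (Gamma (bc_z2 Y))"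

lemma bc_inverse_Gamma: "inverse (bc_Gamma Y) = bc_idem (rGamma (bc_z1 Y)) (rGamma (bc_z2 Y))"
  by (simp add: inverse_bicomplex_def bc_Gamma_def rGamma_inverse_Gamma)

definition log_branch :: "(complex \<Rightarrow> complex) \<Rightarrow> complex set \<Rightarrow> bool" where
  "log_branch L S \<longleftrightarrow> open S \<and> L holomorphic_on S \<and> (\<forall>z\<in>S. exp (L z) = z)"

text \<open>The power \<open>Z\<^sup>W\<close>, where \<open>L1\<close> and \<open>L2\<close> are the branches of the logarithm used in the two components.\<close>

definition bc_power :: "(complex \<Rightarrow> complex) \<Rightarrow> (complex \<Rightarrow> complex) \<Rightarrow> bicomplex \<Rightarrow> bicomplex \<Rightarrow> bicomplex" where
  "bc_power L1 L2 Z W = bc_idem (exp (bc_z1 W * L1 (bc_z1 Z))) (exp (bc_z2 W * L2 (bc_z2 Z)))"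

definition bc_miller_ross ::
  "(complex \<Rightarrow> complex) \<Rightarrow> (complex \<Rightarrow> complex) \<Rightarrow> bicomplex \<Rightarrow> bicomplex \<Rightarrow> bicomplex \<Rightarrow> bicomplex" where
  "bc_miller_ross L1 L2 V C Z =
     bc_power L1 L2 Z V * (\<Sum>r. (C * Z) ^ r / bc_Gamma (V + of_nat r + 1))"

definition bc_has_deriv :: "(bicomplex \<Rightarrow> bicomplex) \<Rightarrow> bicomplex \<Rightarrow> bicomplex \<Rightarrow> bool" where
  "bc_has_deriv f D Z0 \<longleftrightarrow> ((\<lambda>H. (f (Z0 + H) - f Z0) / H) \<longlongrightarrow> D) (at 0 within - bc_O2)"

definition bc_differentiable :: "(bicomplex \<Rightarrow> bicomplex) \<Rightarrow> bicomplex \<Rightarrow> bool" where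
  "bc_differentiable f Z0 \<longleftrightarrow> (\<exists>D. bc_has_deriv f D Z0)"

definition bc_deriv :: "(bicomplex \<Rightarrow> bicomplex) \<Rightarrow> bicomplex \<Rightarrow> bicomplex" where
  "bc_deriv f Z0 = Lim (at 0 within - bc_O2) (\<lambda>H. (f (Z0 + H) - f Z0) / H)"

lemma bc_O2_nontrivial_limit: "at 0 within - bc_O2 \<noteq> bot"
proof -
  have "0 islimpt - bc_O2"
    unfolding islimpt_approachable
  proof (intro allI impI)
    fix e :: real
    assume "e > 0"
    let ?h = "BC (of_real (e / 2)) 0"
    have "?h \<in> - bc_O2" "?h \<noteq> 0" "dist ?h 0 < e"
      using \<open>e > 0\<close> by (simp_all add: bc_O2_def zero_bicomplex_def dist_bicomplex_def
          minus_bicomplex_def norm_bicomplex_def)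
    then show "\<exists>h\<in>- bc_O2. h \<noteq> 0 \<and> dist h 0 < e"
      by blast
  qed
  then show ?thesis
    by (simp add: trivial_limit_within)
qed

lemma bc_has_deriv_imp_deriv: "bc_has_deriv f D Z0 \<Longrightarrow> bc_deriv f Z0 = D"
  unfolding bc_has_deriv_def bc_deriv_def
  by (rule tendsto_Lim[OF bc_O2_nontrivial_limit])

end

theory Submission imports Defs begin

text \<open>In each idempotent component, \<open>u(z) = z\<^sup>\<nu> \<Sum>r. (c z)\<^sup>r / \<Gamma>(\<nu> + r + 1)\<close> satisfies the first-order
  equation \<open>u' = c u + z\<^bsup>\<nu> - 1\<^esup> / \<Gamma>(\<nu>)\<close>, because \<open>(\<nu> + r) / \<Gamma>(\<nu> + r + 1) = 1 / \<Gamma>(\<nu> + r)\<close>. Hence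
  \<open>z (u' - c u)' = (\<nu> - 1) (u' - c u)\<close>, which is the claimed equation.\<close>

section \<open>Idempotent coordinates: continuity, limits and derivatives\<close>

text \<open>Parallelogram law for the pair w1 - i w2, w1 + i w2. It makes the passage to idempotent
  coordinates continuous in both directions.\<close>

lemma norm_bicomplex_z: "(norm Z)\<^sup>2 = ((norm (bc_z1 Z))\<^sup>2 + (norm (bc_z2 Z))\<^sup>2) / 2"
proof -
  obtain a b c d where "Z = BC (Complex a b) (Complex c d)"
    by (metis bicomplex.exhaust complex.exhaust)
  then show ?thesis
    by (simp add: norm_bicomplex_def bc_z1_def bc_z2_def cmod_power2)
       (simp add: power2_eq_square algebra_simps)
qed

lemma bc_z_scaleR [simp]:
  "bc_z1 (r *\<^sub>R X) = r *\<^sub>R bc_z1 X" "bc_z2 (r *\<^sub>R X) = r *\<^sub>R bc_z2 X"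
  by (simp_all add: bc_z1_def bc_z2_def scaleR_bicomplex_def algebra_simps)

lemma norm_bc_z_le: "norm (bc_z1 Z) \<le> norm Z * sqrt 2" "norm (bc_z2 Z) \<le> norm Z * sqrt 2"
  by (rule power2_le_imp_le; simp add: power_mult_distrib norm_bicomplex_z)+

lemma bounded_linear_bc_z1: "bounded_linear bc_z1"
  by (rule bounded_linear_intro[where K = "sqrt 2"]) (simp_all add: norm_bc_z_le)

lemma bounded_linear_bc_z2: "bounded_linear bc_z2"
  by (rule bounded_linear_intro[where K = "sqrt 2"]) (simp_all add: norm_bc_z_le)

lemma bounded_linear_bc_idem: "bounded_linear (\<lambda>(a, b). bc_idem a b)"
proof (rule bounded_linear_intro[where K = 1])
  fix x :: "complex \<times> complex"
  show "norm (case x of (a, b) \<Rightarrow> bc_idem a b) \<le> norm x * 1"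
    by (cases x, rule power2_le_imp_le) (simp_all add: norm_bicomplex_z norm_Pair)
qed (auto simp: bicomplex_eq_iff_z)

lemma tendsto_bc_idem:
  assumes "(f \<longlongrightarrow> a) F" "(g \<longlongrightarrow> b) F"
  shows "((\<lambda>x. bc_idem (f x) (g x)) \<longlongrightarrow> bc_idem a b) F"
  using bounded_linear.tendsto[OF bounded_linear_bc_idem tendsto_Pair[OF assms]] by simp

lemma bc_z_of_nat [simp]: "bc_z1 (of_nat n) = of_nat n" "bc_z2 (of_nat n) = of_nat n"
  by (induction n) simp_all

lemma bc_z_power [simp]: "bc_z1 (X ^ n) = bc_z1 X ^ n" "bc_z2 (X ^ n) = bc_z2 X ^ n"
  by (induction n) simp_all

lemma bc_z_divide [simp]:
  "bc_z1 (X / Y) = bc_z1 X / bc_z1 Y" "bc_z2 (X / Y) = bc_z2 X / bc_z2 Y"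
  by (simp_all add: divide_bicomplex_def inverse_bicomplex_def divide_inverse)

lemma bc_z_sum [simp]:
  "bc_z1 (sum f A) = (\<Sum>x\<in>A. bc_z1 (f x))" "bc_z2 (sum f A) = (\<Sum>x\<in>A. bc_z2 (f x))"
  by (induction A rule: infinite_finite_induct) simp_all

text \<open>Partial sums split into components, and limits pass through the continuous map
  \<open>bc_idem\<close>.\<close>

lemma sums_bc_idem:
  assumes "f sums a" "g sums b"
  shows "(\<lambda>n. bc_idem (f n) (g n)) sums bc_idem a b"
proof -
  have "(\<Sum>k<n. bc_idem (f k) (g k)) = bc_idem (\<Sum>k<n. f k) (\<Sum>k<n. g k)" for n
    by (simp add: bicomplex_eq_iff_z)
  then show ?thesis
    using tendsto_bc_idem[OF assms[unfolded sums_def]] by (simp add: sums_def)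
qed

text \<open>An increment outside \<open>bc_O2\<close> has two nonzero components, so the difference
  quotient splits into two scalar ones whose increments tend to 0 without vanishing. Agreement is
  asked only near Z because the lemma is also applied to \<open>bc_deriv U\<close>, whose component
  form is established only locally.\<close>

lemma bc_has_deriv_idem:
  assumes "(f1 has_field_derivative d1) (at (bc_z1 Z))"
    and "(f2 has_field_derivative d2) (at (bc_z2 Z))"
    and "\<forall>\<^sub>F W in nhds Z. f W = bc_idem (f1 (bc_z1 W)) (f2 (bc_z2 W))"
  shows "bc_has_deriv f (bc_idem d1 d2) Z"
proof -
  let ?F = "at 0 within - bc_O2"
  have nz: "\<forall>\<^sub>F H in ?F. bc_z1 H \<noteq> 0 \<and> bc_z2 H \<noteq> 0"
    by (simp add: eventually_at_filter bc_O2_iff)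
  have z1: "filterlim bc_z1 (at 0) ?F"
    using nz bounded_linear.tendsto[OF bounded_linear_bc_z1 tendsto_ident_at, of 0 "- bc_O2"]
    by (auto simp: filterlim_at elim: eventually_mono)
  have z2: "filterlim bc_z2 (at 0) ?F"
    using nz bounded_linear.tendsto[OF bounded_linear_bc_z2 tendsto_ident_at, of 0 "- bc_O2"]
    by (auto simp: filterlim_at elim: eventually_mono)
  have lim: "((\<lambda>H. bc_idem ((f1 (bc_z1 Z + bc_z1 H) - f1 (bc_z1 Z)) / bc_z1 H)
      ((f2 (bc_z2 Z + bc_z2 H) - f2 (bc_z2 Z)) / bc_z2 H)) \<longlongrightarrow> bc_idem d1 d2) ?F"
    by (intro tendsto_bc_idem filterlim_compose[OF assms(1)[unfolded DERIV_def] z1]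
        filterlim_compose[OF assms(2)[unfolded DERIV_def] z2])
  have "filterlim (\<lambda>H. Z + H) (nhds Z) ?F"
    using tendsto_add[OF tendsto_const tendsto_ident_at, of Z 0 "- bc_O2"] by simp
  from eventually_compose_filterlim[OF assms(3) this]
  have "\<forall>\<^sub>F H in ?F. bc_idem ((f1 (bc_z1 Z + bc_z1 H) - f1 (bc_z1 Z)) / bc_z1 H)
      ((f2 (bc_z2 Z + bc_z2 H) - f2 (bc_z2 Z)) / bc_z2 H) = (f (Z + H) - f Z) / H"
    by eventually_elim (simp add: bicomplex_eq_iff_z eventually_nhds_x_imp_x[OF assms(3)])
  from Lim_transform_eventually[OF lim this] show ?thesis
    by (simp add: bc_has_deriv_def)
qed

section \<open>The scalar power series\<close>

text \<open>This is the two-parameter Mittag-Leffler function with parameters 1 and \<nu> + 1.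
  Writing it with \<open>rGamma\<close> builds in the value 0 of 1/Gamma at the poles.\<close>

definition mr_series :: "complex \<Rightarrow> complex \<Rightarrow> complex" where
  "mr_series \<nu> w = (\<Sum>r. rGamma (\<nu> + of_nat r + 1) * w ^ r)"

lemma rGamma_shift: "rGamma (\<nu> + of_nat r + 1) * (\<nu> + of_nat r) = rGamma (\<nu> + of_nat r :: complex)"
  using rGamma_plus1[of "\<nu> + of_nat r"] by (simp add: mult.commute)

text \<open>Ratio test: by the functional equation of \<open>rGamma\<close>, consecutive terms
  differ by the factor w / (\<nu> + n + 1).\<close>

lemma summable_mr_series: "summable (\<lambda>r. rGamma (\<nu> + of_nat r + 1) * w ^ r :: complex)"
proof -
  \<comment> \<open>This size forces |\<nu> + n + 1| \<ge> 2 |w| for all n \<ge> N, hence ratio at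
    most 1/2.\<close>
  obtain N :: nat where N: "real N > norm \<nu> + 2 * norm w"
    using reals_Archimedean2 by blast
  show ?thesis
  proof (rule summable_ratio_test[of "1/2" N])
    fix n assume "n \<ge> N"
    let ?s = "\<nu> + of_nat n + 1 :: complex"
    have "real n + 1 \<le> norm ?s + norm \<nu>"
      using norm_triangle_ineq4[of ?s \<nu>] norm_of_nat[of "Suc n", where 'a = complex]
      by (simp add: algebra_simps)
    then have "2 * norm w \<le> norm ?s"
      using N \<open>n \<ge> N\<close> by linarith
    then have "2 * norm w * norm (rGamma (?s + 1) * w ^ n)
        \<le> norm ?s * norm (rGamma (?s + 1) * w ^ n)"
      by (rule mult_right_mono) simp
    also have "\<dots> = norm (rGamma ?s * w ^ n)"
      using rGamma_plus1[of ?s] by (metis norm_mult mult.assoc)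
    finally show "norm (rGamma (\<nu> + of_nat (Suc n) + 1) * w ^ Suc n)
        \<le> 1/2 * norm (rGamma ?s * w ^ n)"
      by (simp add: norm_mult algebra_simps)
  qed simp
qed

text \<open>The operator w d/dw + \<nu> multiplies the r-th coefficient by \<nu> + r, which by
  \<open>rGamma_shift\<close> only shifts the index. Stating the equation for w * D keeps w = 0
  included, as needed when a component of C vanishes.\<close>

lemma mr_series_has_field_derivative:
  obtains D where "(mr_series \<nu> has_field_derivative D) (at w)"
    and "w * D = rGamma \<nu> + (w - \<nu>) * mr_series \<nu> w"
proof
  let ?a = "\<lambda>r. rGamma (\<nu> + of_nat r + 1)"
  let ?D = "\<Sum>r. diffs ?a r * w ^ r"
  show "(mr_series \<nu> has_field_derivative ?D) (at w)"
    unfolding mr_series_def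
    by (rule termdiffs_strong_converges_everywhere) (rule summable_mr_series)
  have "summable (\<lambda>r. diffs ?a r * w ^ r)"
    by (rule termdiff_converges_all) (rule summable_mr_series)
  then have "(\<lambda>r. of_nat r * ?a r * w ^ (r - Suc 0)) sums ?D"
    by (rule diffs_equiv)
  \<comment> \<open>At r = 0 the truncated exponent r - 1 is harmless, since the factor
    \<open>of_nat r\<close> is 0.\<close>
  from sums_mult[OF this, of w]
  have "(\<lambda>r. of_nat r * (?a r * w ^ r)) sums (w * ?D)"
    by (rule back_subst[of "\<lambda>f. f sums _"]) (auto simp: fun_eq_iff power_eq_if)
  moreover have F: "(\<lambda>r. ?a r * w ^ r) sums mr_series \<nu> w"
    unfolding mr_series_def by (intro summable_sums summable_mr_series)
  ultimately have "(\<lambda>r. of_nat r * (?a r * w ^ r) + \<nu> * (?a r * w ^ r))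
      sums (w * ?D + \<nu> * mr_series \<nu> w)"
    by (intro sums_add sums_mult)
  moreover have "of_nat r * (?a r * w ^ r) + \<nu> * (?a r * w ^ r) = rGamma (\<nu> + of_nat r) * w ^ r" for r
    by (simp add: algebra_simps flip: rGamma_shift)
  ultimately have "(\<lambda>r. rGamma (\<nu> + of_nat r) * w ^ r) sums (w * ?D + \<nu> * mr_series \<nu> w)"
    by simp
  \<comment> \<open>Second evaluation of the same series: its tail is w times the original series,
    and the split-off term at r = 0 is \<open>rGamma \<nu>\<close>.\<close>
  moreover have "(\<lambda>r. rGamma (\<nu> + of_nat r) * w ^ r) sums (w * mr_series \<nu> w + rGamma \<nu>)"
  proof -
    have "(\<lambda>r. rGamma (\<nu> + of_nat (Suc r)) * w ^ Suc r) sums (w * mr_series \<nu> w)"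
      using sums_mult[OF F, of w] by (simp add: algebra_simps)
    from sums_Suc[OF this] show ?thesis
      by simp
  qed
  ultimately have "w * ?D + \<nu> * mr_series \<nu> w = w * mr_series \<nu> w + rGamma \<nu>"
    by (rule sums_unique2)
  then show "w * ?D = rGamma \<nu> + (w - \<nu>) * mr_series \<nu> w"
    by (simp add: algebra_simps)
qed

section \<open>The scalar Miller-Ross function and its equation\<close>

definition miller_ross :: "(complex \<Rightarrow> complex) \<Rightarrow> complex \<Rightarrow> complex \<Rightarrow> complex \<Rightarrow> complex" where
  "miller_ross L \<nu> c z = exp (\<nu> * L z) * mr_series \<nu> (c * z)"

text \<open>Closed form of the first derivative, ready to be differentiated again. On the domain of
  the branch, \<open>exp (\<nu> * L z) / z\<close> is the power with exponent \<nu> - 1 for the same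
  branch.\<close>

definition miller_ross' :: "(complex \<Rightarrow> complex) \<Rightarrow> complex \<Rightarrow> complex \<Rightarrow> complex \<Rightarrow> complex" where
  "miller_ross' L \<nu> c z = c * miller_ross L \<nu> c z + rGamma \<nu> * exp (\<nu> * L z) / z"

lemma bc_miller_ross_idem:
  "bc_miller_ross L1 L2 V C Z =
    bc_idem (miller_ross L1 (bc_z1 V) (bc_z1 C) (bc_z1 Z)) (miller_ross L2 (bc_z2 V) (bc_z2 C) (bc_z2 Z))"
proof -
  have "(C * Z) ^ r / bc_Gamma (V + of_nat r + 1) =
      bc_idem (rGamma (bc_z1 V + of_nat r + 1) * (bc_z1 C * bc_z1 Z) ^ r)
        (rGamma (bc_z2 V + of_nat r + 1) * (bc_z2 C * bc_z2 Z) ^ r)" for r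
    by (simp add: bicomplex_eq_iff_z bc_Gamma_def rGamma_inverse_Gamma divide_inverse)
  then have "(\<lambda>r. (C * Z) ^ r / bc_Gamma (V + of_nat r + 1)) sums
      bc_idem (mr_series (bc_z1 V) (bc_z1 C * bc_z1 Z)) (mr_series (bc_z2 V) (bc_z2 C * bc_z2 Z))"
    unfolding mr_series_def by (simp only: sums_bc_idem summable_sums summable_mr_series)
  from sums_unique[OF this, symmetric] show ?thesis
    by (simp add: bc_miller_ross_def bc_power_def bicomplex_eq_iff_z miller_ross_def)
qed

lemma log_branch_nonzero: "log_branch L S \<Longrightarrow> z \<in> S \<Longrightarrow> z \<noteq> 0"
  by (metis log_branch_def exp_not_eq_zero)

text \<open>Differentiating exp (L x) = x on the open set S gives z L'(z) = 1.\<close>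

lemma log_branch_has_field_derivative:
  assumes "log_branch L S" "z \<in> S"
  shows "(L has_field_derivative inverse z) (at z)"
proof -
  have S: "open S" "\<And>x. x \<in> S \<Longrightarrow> exp (L x) = x" and "L holomorphic_on S"
    using assms by (auto simp: log_branch_def)
  then have L: "(L has_field_derivative deriv L z) (at z)"
    using assms holomorphic_derivI by blast
  have "((\<lambda>x. exp (L x)) has_field_derivative z * deriv L z) (at z)"
    using L S assms by (auto intro!: derivative_eq_intros)
  moreover have "((\<lambda>x. exp (L x)) has_field_derivative 1) (at z)"
    by (rule has_field_derivative_transform_within_open[OF DERIV_ident]) (use S assms in auto)
  ultimately have "z * deriv L z = 1"
    by (rule DERIV_unique)
  with L show ?thesis
    by (simp add: inverse_unique)
qed

lemma miller_ross_has_field_derivative: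
  assumes "log_branch L S" "z \<in> S"
  shows "(miller_ross L \<nu> c has_field_derivative miller_ross' L \<nu> c z) (at z)"
proof -
  note [derivative_intros] = log_branch_has_field_derivative[OF assms]
  obtain D where D: "(mr_series \<nu> has_field_derivative D) (at (c * z))"
    and eq: "c * z * D = rGamma \<nu> + (c * z - \<nu>) * mr_series \<nu> (c * z)"
    by (rule mr_series_has_field_derivative)
  have "z \<noteq> 0"
    using assms log_branch_nonzero by blast
  \<comment> \<open>Dividing by z rather than by c * z determines c * D also when c = 0; the chain
    rule needs only this product.\<close>
  then have cD: "c * D = (rGamma \<nu> + (c * z - \<nu>) * mr_series \<nu> (c * z)) / z"
    using eq by (simp add: field_simps)
  have "(miller_ross L \<nu> c has_field_derivative
      exp (\<nu> * L z) * (\<nu> / z) * mr_series \<nu> (c * z) + exp (\<nu> * L z) * (c * D)) (at z)"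
    unfolding miller_ross_def
    by (rule derivative_eq_intros DERIV_chain2[where f = "mr_series \<nu>" and g = "(*) c", OF D] refl)+
      (simp add: divide_inverse)
  also have "exp (\<nu> * L z) * (\<nu> / z) * mr_series \<nu> (c * z) + exp (\<nu> * L z) * (c * D)
      = miller_ross' L \<nu> c z"
    unfolding cD miller_ross'_def miller_ross_def using \<open>z \<noteq> 0\<close> by (simp add: field_simps)
  finally show ?thesis .
qed

lemma miller_ross'_has_field_derivative:
  assumes "log_branch L S" "z \<in> S"
  shows "(miller_ross' L \<nu> c has_field_derivative
    c * miller_ross' L \<nu> c z + (\<nu> - 1) * rGamma \<nu> * exp (\<nu> * L z) / z\<^sup>2) (at z)"
proof -
  note [derivative_intros] = log_branch_has_field_derivative[OF assms]
    miller_ross_has_field_derivative[OF assms]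
  have "z \<noteq> 0"
    using assms log_branch_nonzero by blast
  then show ?thesis
    unfolding miller_ross'_def[abs_def]
    by (auto intro!: derivative_eq_intros simp: miller_ross'_def field_simps power2_eq_square)
qed

text \<open>Pure algebra: the factor after the first z is the second derivative found in
  \<open>miller_ross'_has_field_derivative\<close>.\<close>

lemma miller_ross_ode:
  assumes "z \<noteq> 0"
  shows "z * (c * miller_ross' L \<nu> c z + (\<nu> - 1) * rGamma \<nu> * exp (\<nu> * L z) / z\<^sup>2)
    + (1 - \<nu> - c * z) * miller_ross' L \<nu> c z + (\<nu> - 1) * c * miller_ross L \<nu> c z = 0"
  using assms by (simp add: miller_ross'_def field_simps power2_eq_square)

section \<open>Transfer to the bicomplex equation\<close>

theorem theorem4p3:
  fixes Z V C :: bicomplex and \<alpha> \<beta> :: complex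
    and L1 L2 :: "complex \<Rightarrow> complex" and S1 S2 :: "complex set"
    and U :: "bicomplex \<Rightarrow> bicomplex"
  assumes "V = bc_of_complex \<alpha> + bc_j * bc_of_complex \<beta>"
    and "Re \<alpha> + 1 > \<bar>Im \<beta>\<bar>"
    and "Z \<notin> bc_O2"
    and "log_branch L1 S1" and "bc_z1 Z \<in> S1"
    and "log_branch L2 S2" and "bc_z2 Z \<in> S2"
    and "U = bc_miller_ross L1 L2 V C"
  shows "(\<forall>\<^sub>F W in nhds Z. bc_differentiable U W) \<and>
    bc_differentiable (bc_deriv U) Z \<and>
    Z * bc_deriv (bc_deriv U) Z + (1 - V - C * Z) * bc_deriv U Z + (V - 1) * C * U Z = 0"
proof -
  note L1 = \<open>log_branch L1 S1\<close> and L2 = \<open>log_branch L2 S2\<close>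
  let ?D = "\<lambda>W. bc_idem (miller_ross' L1 (bc_z1 V) (bc_z1 C) (bc_z1 W))
    (miller_ross' L2 (bc_z2 V) (bc_z2 C) (bc_z2 W))"
  have U: "U W = bc_idem (miller_ross L1 (bc_z1 V) (bc_z1 C) (bc_z1 W))
      (miller_ross L2 (bc_z2 V) (bc_z2 C) (bc_z2 W))" for W
    by (simp add: assms(8) bc_miller_ross_idem)
  have U': "bc_has_deriv U (?D W) W" if "bc_z1 W \<in> S1" "bc_z2 W \<in> S2" for W
    by (rule bc_has_deriv_idem[OF miller_ross_has_field_derivative[OF L1 that(1)]
          miller_ross_has_field_derivative[OF L2 that(2)]]) (simp add: U)
  \<comment> \<open>The second derivative needs \<open>bc_deriv U\<close> on a neighbourhood of Z.
    The coordinates are continuous and S1, S2 are open, so both branches remain valid there.\<close>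
  have "\<forall>\<^sub>F W in nhds Z. bc_z1 W \<in> S1"
    by (rule topological_tendstoD[OF bounded_linear.tendsto[OF bounded_linear_bc_z1 filterlim_ident]])
      (use assms(5) L1 in \<open>auto simp: log_branch_def\<close>)
  moreover have "\<forall>\<^sub>F W in nhds Z. bc_z2 W \<in> S2"
    by (rule topological_tendstoD[OF bounded_linear.tendsto[OF bounded_linear_bc_z2 filterlim_ident]])
      (use assms(7) L2 in \<open>auto simp: log_branch_def\<close>)
  ultimately have ev: "\<forall>\<^sub>F W in nhds Z. bc_has_deriv U (?D W) W"
    by eventually_elim (rule U')
  then have diff: "\<forall>\<^sub>F W in nhds Z. bc_differentiable U W"
    by eventually_elim (auto simp: bc_differentiable_def)
  from ev have D: "\<forall>\<^sub>F W in nhds Z. bc_deriv U W = ?D W"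
    by eventually_elim (rule bc_has_deriv_imp_deriv)
  note U'' = bc_has_deriv_idem[OF miller_ross'_has_field_derivative[OF L1 assms(5)]
      miller_ross'_has_field_derivative[OF L2 assms(7)] D]
  have "Z * bc_deriv (bc_deriv U) Z + (1 - V - C * Z) * bc_deriv U Z + (V - 1) * C * U Z = 0"
    \<comment> \<open>In idempotent coordinates the equation is two independent scalar
      equations.\<close>
    using miller_ross_ode[OF log_branch_nonzero[OF L1 assms(5)]]
      miller_ross_ode[OF log_branch_nonzero[OF L2 assms(7)]]
    by (simp add: bicomplex_eq_iff_z bc_has_deriv_imp_deriv[OF U'']
        eventually_nhds_x_imp_x[OF D] U)
  with diff U'' show ?thesis
    by (auto simp: bc_differentiable_def)
qed

end
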